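(* Let $n\geq1$ and let $u,v\in\mathcal{C}_n^{*}$ be the readings of two admissible columns $U$ and $V$ respectively. Then the symplectic tableau $P(uv)$ consists of at most two columns.
   Context: **Words and crystal operators.** Let $\mathcal{C}_n=\{1<2<\dots<n<\overline{n}<\dots<\overline{2}<\overline{1}\}$, a totally ordered alphabet, and $\mathcal{C}_n^{*}$ the free monoid on it. The letters $1,\dots,n$ are called unbarred. For $i\in\{1,\dots,n\}$ and a word $w$, the operators $\widetilde e_i,\widetilde f_i:\mathcal{C}_n^{*}\to\mathcal{C}_n^{*}\cup\{0\}$ are defined as follows. Keep only the letters $i,i+1,\overline{i+1},\overline{i}$ of $w$ (only $n,\overline n$ if $i=n$); mark $i$ and $\overline{i+1}$ by $+$, and $i+1$ and $\overline{i}$ by $-$ (for $i=n$: $n$ by $+$, $\overline n$ by $-$). Repeatedly delete adjacent pairs marked $+-$ (in this order) until none is left; the remaining letters are marked $-^r+^s$. If $r>0$, $\widetilde e_i(w)$ is obtained from $w$ by changing the letter of the rightmost remaining $-$ ($i+1\mapsto i$, $\overline i\mapsto\overline{i+1}$, and for $i=n$: $\overline n\mapsto n$); if $r=0$, $\widetilde e_i(w)=0$. If $s>0$, $\widetilde f_i(w)$ is obtained from $w$ by changing the letter of the leftmost remaining $+$ ($i\mapsto i+1$, $\overline{i+1}\mapsto\overline i$, and for $i=n$: $n\mapsto\overline n$); if $s=0$, $\widetilde f_i(w)=0$. The crystal graph $G_n$ has vertex set $\mathcal{C}_n^{*}$ and an arrow $a\xrightarrow{i}b$ whenever $\widetilde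 f_i(a)=b$. Let $B(w)$ be the connected component of $w$; it contains a unique vertex $w^0$ with $\widetilde e_i(w^0)=0$ for all $i$. The weight of a word is determined by $(d_1,\dots,d_n)$, where $d_i$ is its number of letters $i$ minus its number of letters $\overline i$. For words $u,v$, $u\sim v$ means that $B(u)$ and $B(v)$ are isomorphic by a weight-preserving isomorphism of labelled directed graphs and that $u$ and $v$ correspond under it, i.e. $u^0$ and $v^0$ have the same weight and there are $i_1,\dots,i_r$ with $u=\widetilde f_{i_1}\cdots\widetilde f_{i_r}(u^0)$ and $v=\widetilde f_{i_1}\cdots\widetilde f_{i_r}(v^0)$. **Admissible columns.** A column $U$ is a one-column Young diagram filled with letters of $\mathcal{C}_n$ strictly increasing from top to bottom; its reading $\mathrm{w}(U)$ is the word read from top to bottom, and $h(U)$ is its number of letters. $U$ is admissible if for every $m\in\{1,\dots,n\}$ the number $N(m)$ of letters $x$ of $U$ with $x\leq m$ or $x\geq\overline m$ satisfies $N(m)\leq m$. For an admissible column $U$ let $I=\{x_1>\dots>x_r\}$ be the set of unbarred $x$ with $x,\overline x\in U$. There is then (known fact) a set $J=\{y_1>\dots>y_r\}$ of unbarred letters such that $y_1$ is the greatest letter with $y_1<x_1$, $y_1,\overline{y_1}\notin U$, and for $i\geq2$, $y_i$ is the greatest letter with $y_i<\min(y_{i-1},x_i)$, $y_i,\overline{y_i}\notin U$. The column $rU$ is obtained from $U$ by replacing each $\overline{x_i}$ by $\overline{y_i}$ and reordering; $lU$ is obtained by replacing each $x_i$ by $y_i$ and reordering. **Symplectic tableaux.**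 For columns $U_1,U_2$, write $U_1\leq U_2$ if $h(U_1)\geq h(U_2)$ and, placing $U_1$ to the left of $U_2$ with tops aligned, rows are weakly increasing from left to right. For admissible columns, $U_1\preceq U_2$ means $rU_1\leq lU_2$. A symplectic tableau is $T=U_1\dots U_r$ (nonempty columns listed from left to right) with all $U_i$ admissible and $U_i\preceq U_{i+1}$ for all $i$; its reading is $\mathrm{w}(T)=\mathrm{w}(U_r)\mathrm{w}(U_{r-1})\cdots\mathrm{w}(U_1)$. It is known (Lecouvey) that for every word $w$ there is a unique symplectic tableau $P(w)$ with $w\sim\mathrm{w}(P(w))$ (possibly the empty tableau, with zero columns). *)

theory Defs
  imports Main
begin

section \<open>The alphabet\<close>

text \<open>The order below does not depend on the rank: on \<open>alphabet n\<close> it restricts to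
  \<open>1 < 2 < \<dots> < n < bar n < \<dots> < bar 2 < bar 1\<close>.\<close>

datatype letter = Unbarred nat | Barred nat

instantiation letter :: linorder
begin

fun less_eq_letter :: "letter \<Rightarrow> letter \<Rightarrow> bool" where
  "Unbarred i \<le> Unbarred j \<longleftrightarrow> i \<le> j"
| "Unbarred i \<le> Barred j \<longleftrightarrow> True"
| "Barred i \<le> Unbarred j \<longleftrightarrow> False"
| "Barred i \<le> Barred j \<longleftrightarrow> j \<le> i"

definition less_letter :: "letter \<Rightarrow> letter \<Rightarrow> bool" where
  "less_letter a b \<longleftrightarrow> a \<le> b \<and> \<not> b \<le> a"

instance
proof
  fix x y z :: letter
  show "x < y \<longleftrightarrow> x \<le> y \<and> \<not> y \<le> x" by (simp add: less_letter_def)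
  show "x \<le> x" by (cases x) auto
  show "x \<le> y \<Longrightarrow> y \<le> z \<Longrightarrow> x \<le> z" by (cases x; cases y; cases z) auto
  show "x \<le> y \<Longrightarrow> y \<le> x \<Longrightarrow> x = y" by (cases x; cases y) auto
  show "x \<le> y \<or> y \<le> x" by (cases x; cases y) auto
qed

end

definition alphabet :: "nat \<Rightarrow> letter set" where
  "alphabet n = Unbarred ` {1..n} \<union> Barred ` {1..n}"

type_synonym word = "letter list"

definition words :: "nat \<Rightarrow> word set" where
  "words n = lists (alphabet n)"


section \<open>Crystal operators\<close>

definition plus_letters :: "nat \<Rightarrow> nat \<Rightarrow> letter set" where
  "plus_letters n i = (if i = n then {Unbarred n} else {Unbarred i, Barred (Suc i)})"

definition minus_letters :: "nat \<Rightarrow> nat \<Rightarrow> letter set" where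
  "minus_letters n i = (if i = n then {Barred n} else {Unbarred (Suc i), Barred i})"

text \<open>A marked position is a pair of a position in the word and a mark, \<open>True\<close> standing for
  \<open>+\<close> and \<open>False\<close> for \<open>-\<close>.\<close>

definition marks :: "nat \<Rightarrow> nat \<Rightarrow> word \<Rightarrow> (nat \<times> bool) list" where
  "marks n i w =
     map (\<lambda>k. (k, w ! k \<in> plus_letters n i))
       (filter (\<lambda>k. w ! k \<in> plus_letters n i \<union> minus_letters n i) [0..<length w])"

inductive delete_pair :: "(nat \<times> bool) list \<Rightarrow> (nat \<times> bool) list \<Rightarrow> bool" where
  "delete_pair (xs @ [(k, True), (l, False)] @ ys) (xs @ ys)"

text \<open>The function \<open>reduce\<close> computes the result of repeatedly deleting adjacent pairs \<open>+-\<close>;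
  by \<open>delete_pair_reduce\<close> and \<open>reduce_unique\<close> below, the order of the deletions is irrelevant.\<close>

fun add_mark :: "nat \<times> bool \<Rightarrow> (nat \<times> bool) list \<Rightarrow> (nat \<times> bool) list" where
  "add_mark (k, True) ((l, False) # ys) = ys"
| "add_mark x ys = x # ys"

definition reduce :: "(nat \<times> bool) list \<Rightarrow> (nat \<times> bool) list" where
  "reduce xs = foldr add_mark xs []"

lemma delete_pair_Cons: "delete_pair xs ys \<Longrightarrow> delete_pair (x # xs) (x # ys)"
  by (metis append_Cons delete_pair.simps)

lemma delete_pairs_Cons: "delete_pair\<^sup>*\<^sup>* xs ys \<Longrightarrow> delete_pair\<^sup>*\<^sup>* (x # xs) (x # ys)"
  by (induction rule: rtranclp_induct) (auto intro: delete_pair_Cons rtranclp.rtrancl_into_rtrancl)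

lemma add_mark_cases:
  "add_mark x ys = x # ys \<or> delete_pair (x # ys) (add_mark x ys)"
  using delete_pair.intros[of "[]"] by (cases "(x, ys)" rule: add_mark.cases) auto

lemma delete_pair_reduce: "delete_pair\<^sup>*\<^sup>* xs (reduce xs)"
proof (induction xs)
  case Nil
  show ?case by (simp add: reduce_def)
next
  case (Cons x xs)
  have "delete_pair\<^sup>*\<^sup>* (x # xs) (x # reduce xs)"
    using Cons by (rule delete_pairs_Cons)
  moreover have "delete_pair\<^sup>*\<^sup>* (x # reduce xs) (reduce (x # xs))"
    using add_mark_cases[of x "reduce xs"] by (auto simp: reduce_def)
  ultimately show ?case by (rule rtranclp_trans)
qed

lemma reduce_delete_pair: "delete_pair xs ys \<Longrightarrow> reduce xs = reduce ys"
  by (auto simp: reduce_def elim!: delete_pair.cases)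

lemma reduce_irreducible: "\<nexists>ys. delete_pair xs ys \<Longrightarrow> reduce xs = xs"
proof (induction xs)
  case Nil
  show ?case by (simp add: reduce_def)
next
  case (Cons x xs)
  then have "reduce xs = xs"
    using delete_pair_Cons by blast
  then show ?case
    using Cons.prems add_mark_cases[of x xs] by (auto simp: reduce_def)
qed

lemma reduce_unique:
  assumes "delete_pair\<^sup>*\<^sup>* xs ys" "\<nexists>zs. delete_pair ys zs"
  shows "ys = reduce xs"
proof -
  from assms(1) have "reduce xs = reduce ys"
    by (induction rule: rtranclp_induct) (auto dest: reduce_delete_pair)
  with reduce_irreducible[OF assms(2)] show ?thesis by simp
qed

definition remaining :: "nat \<Rightarrow> nat \<Rightarrow> word \<Rightarrow> (nat \<times> bool) list" where
  "remaining n i w = reduce (marks n i w)"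

text \<open>Only the values on \<open>plus_letters n i\<close> matter.\<close>

fun f_letter :: "nat \<Rightarrow> nat \<Rightarrow> letter \<Rightarrow> letter" where
  "f_letter n i (Unbarred j) = (if i = n then Barred n else Unbarred (Suc i))"
| "f_letter n i (Barred j) = Barred i"

text \<open>The value \<open>None\<close> stands for the extra element \<open>0\<close>.\<close>

definition f_op :: "nat \<Rightarrow> nat \<Rightarrow> word \<Rightarrow> word option" where
  "f_op n i w =
     (case filter snd (remaining n i w) of
        [] \<Rightarrow> None
      | (k, _) # _ \<Rightarrow> Some (w[k := f_letter n i (w ! k)]))"

section \<open>The crystal graph and the plactic equivalence\<close>

definition arrow :: "nat \<Rightarrow> nat \<Rightarrow> word \<Rightarrow> word \<Rightarrow> bool" where
  "arrow n i a b \<longleftrightarrow> i \<in> {1..n} \<and> a \<in> words n \<and> b \<in> words n \<and> f_op n i a = Some b"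

definition component :: "nat \<Rightarrow> word \<Rightarrow> word set" where
  "component n w = {x. (\<lambda>a b. \<exists>i. arrow n i a b \<or> arrow n i b a)\<^sup>*\<^sup>* w x}"

definition weight :: "word \<Rightarrow> nat \<Rightarrow> int" where
  "weight w i = int (count_list w (Unbarred i)) - int (count_list w (Barred i))"

definition crystal_iso :: "nat \<Rightarrow> word \<Rightarrow> word \<Rightarrow> (word \<Rightarrow> word) \<Rightarrow> bool" where
  "crystal_iso n u v \<phi> \<longleftrightarrow>
     bij_betw \<phi> (component n u) (component n v) \<and>
     (\<forall>a\<in>component n u. \<forall>b\<in>component n u. \<forall>i\<in>{1..n}.
        arrow n i a b \<longleftrightarrow> arrow n i (\<phi> a) (\<phi> b)) \<and>
     (\<forall>a\<in>component n u. \<forall>i\<in>{1..n}. weight (\<phi> a) i = weight a i)"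

definition crystal_equiv :: "nat \<Rightarrow> word \<Rightarrow> word \<Rightarrow> bool" where
  "crystal_equiv n u v \<longleftrightarrow> (\<exists>\<phi>. crystal_iso n u v \<phi> \<and> \<phi> u = v)"


section \<open>Admissible columns\<close>

text \<open>A column is identified with its reading, the list of its letters from top to bottom.\<close>

definition is_column :: "nat \<Rightarrow> letter list \<Rightarrow> bool" where
  "is_column n U \<longleftrightarrow> U \<in> words n \<and> sorted_wrt (<) U"

definition admissible :: "nat \<Rightarrow> letter list \<Rightarrow> bool" where
  "admissible n U \<longleftrightarrow> is_column n U \<and>
     (\<forall>m\<in>{1..n}. card {x \<in> set U. x \<le> Unbarred m \<or> Barred m \<le> x} \<le> m)"

text \<open>The sets \<open>I\<close> and \<open>J\<close> are kept as the decreasing lists \<open>x\<^sub>1 > \<dots> > x\<^sub>r\<close> and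
  \<open>y\<^sub>1 > \<dots> > y\<^sub>r\<close>. In \<open>greedy U y xs\<close> the number \<open>y\<close> is the previously chosen letter;
  there is none at the start, where \<open>x\<^sub>1\<close> itself is used because \<open>min x\<^sub>1 x\<^sub>1 = x\<^sub>1\<close>.
  For admissible columns the sets whose maxima are taken are nonempty.\<close>

definition I_list :: "letter list \<Rightarrow> nat list" where
  "I_list U = rev (sorted_list_of_set {x. Unbarred x \<in> set U \<and> Barred x \<in> set U})"

fun greedy :: "letter list \<Rightarrow> nat \<Rightarrow> nat list \<Rightarrow> nat list" where
  "greedy U y [] = []"
| "greedy U y (x # xs) =
     (let y' = Max {z. 1 \<le> z \<and> z < min y x \<and> Unbarred z \<notin> set U \<and> Barred z \<notin> set U}
      in y' # greedy U y' xs)"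

definition J_list :: "letter list \<Rightarrow> nat list" where
  "J_list U = (case I_list U of [] \<Rightarrow> [] | x # xs \<Rightarrow> greedy U x (x # xs))"

definition r_col :: "letter list \<Rightarrow> letter list" where
  "r_col U = sorted_list_of_set
     (set U - Barred ` set (I_list U) \<union> Barred ` set (J_list U))"

definition l_col :: "letter list \<Rightarrow> letter list" where
  "l_col U = sorted_list_of_set
     (set U - Unbarred ` set (I_list U) \<union> Unbarred ` set (J_list U))"


section \<open>Symplectic tableaux\<close>

definition col_le :: "letter list \<Rightarrow> letter list \<Rightarrow> bool" where
  "col_le U V \<longleftrightarrow> length V \<le> length U \<and> (\<forall>k<length V. U ! k \<le> V ! k)"

definition col_preceq :: "letter list \<Rightarrow> letter list \<Rightarrow> bool" where
  "col_preceq U V \<longleftrightarrow> col_le (r_col U) (l_col V)"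

text \<open>A tableau is the list of its columns from left to right.\<close>

definition symplectic_tableau :: "nat \<Rightarrow> letter list list \<Rightarrow> bool" where
  "symplectic_tableau n T \<longleftrightarrow>
     (\<forall>U\<in>set T. U \<noteq> [] \<and> admissible n U) \<and>
     (\<forall>k. Suc k < length T \<longrightarrow> col_preceq (T ! k) (T ! Suc k))"

definition tableau_reading :: "letter list list \<Rightarrow> word" where
  "tableau_reading T = concat (rev T)"

text \<open>\<open>is_P n w T\<close> says that \<open>T\<close> is the tableau \<open>P(w)\<close>, through the property that
  characterises \<open>P(w)\<close> uniquely.\<close>

definition is_P :: "nat \<Rightarrow> word \<Rightarrow> letter list list \<Rightarrow> bool" where
  "is_P n w T \<longleftrightarrow> symplectic_tableau n T \<and> crystal_equiv n w (tableau_reading T)"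

end

(*
  Being the concatenation of two strictly increasing words is preserved by all crystal
  operators, so every word in the component of U @ V has d_1 <= 2. Conversely the component of
  w(T) contains a word with d_1 equal to the number of columns of T. To see this, keep only the
  part of the tableau condition that concerns top letters, namely that the top of each column is
  at most every letter of l of the next one. This weaker condition is preserved by the raising
  operators e_i, unlike by the f_i. Raising until the first letter of the word is 1 forces all
  tops to be 1. An isomorphism of components preserves weights, so T has at most two columns.
*)
theory Submission
  imports Defs
begin

section \<open>Crystal operators by recursion on the word\<close>

text \<open>The number of unpaired letters marked \<open>-\<close>.\<close>

fun eps :: "nat \<Rightarrow> nat \<Rightarrow> word \<Rightarrow> nat" where
  "eps n i [] = 0"
| "eps n i (x # w) =
     (if x \<in> plus_letters n i then eps n i w - 1
      else if x \<in> minus_letters n i then Suc (eps n i w) else eps n i w)"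

text \<open>A leading + survives exactly when no unpaired - follows it, and then it is the leftmost
  survivor. In \<open>eps\<close> the truncated \<open>- 1\<close> covers both a + that deletes a -
  and a + with nothing to delete.\<close>

fun f_rec :: "nat \<Rightarrow> nat \<Rightarrow> word \<Rightarrow> word option" where
  "f_rec n i [] = None"
| "f_rec n i (x # w) =
     (if x \<in> plus_letters n i \<and> eps n i w = 0 then Some (f_letter n i x # w)
      else map_option ((#) x) (f_rec n i w))"

lemma marks_Cons:
  "marks n i (x # w) =
     (if x \<in> plus_letters n i \<union> minus_letters n i then [(0, x \<in> plus_letters n i)] else [])
       @ map (apfst Suc) (marks n i w)"
proof -
  have "[0..<length (x # w)] = 0 # map Suc [0..<length w]"
    by (simp add: upt_conv_Cons map_Suc_upt del: upt_Suc)
  then show ?thesis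
    unfolding marks_def by (simp only:) (simp add: filter_map o_def)
qed

text \<open>Deletion looks at the marks only, so renumbering the positions commutes with it.\<close>

lemma reduce_map: "reduce (map (apfst g) xs) = map (apfst g) (reduce xs)"
proof (induction xs)
  case (Cons x xs)
  have "add_mark (apfst g x) (map (apfst g) ys) = map (apfst g) (add_mark x ys)" for ys
    by (cases "(x, ys)" rule: add_mark.cases) auto
  with Cons show ?case by (simp add: reduce_def)
qed (simp add: reduce_def)

lemma remaining_Cons:
  "remaining n i (x # w) =
     (if x \<in> plus_letters n i \<union> minus_letters n i
      then add_mark (0, x \<in> plus_letters n i) (map (apfst Suc) (remaining n i w))
      else map (apfst Suc) (remaining n i w))"
  by (simp add: remaining_def marks_Cons reduce_map[symmetric]) (simp add: reduce_def)

text \<open>\<open>A\<close> and \<open>B\<close> hold the positions of the remaining - and +.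
  Scanning from the right keeps this shape: a new + either deletes the first - or, when
  \<open>A\<close> is empty, becomes the first +.\<close>

lemma remaining_f_rec:
  "\<exists>A B. remaining n i w = map (\<lambda>k. (k, False)) A @ map (\<lambda>k. (k, True)) B \<and>
     length A = eps n i w \<and>
     f_rec n i w = (case B of [] \<Rightarrow> None | k # _ \<Rightarrow> Some (w[k := f_letter n i (w ! k)]))"
proof (induction w)
  case Nil
  show ?case by (simp add: remaining_def marks_def reduce_def)
next
  case (Cons x w)
  then obtain A B where AB: "remaining n i w = map (\<lambda>k. (k, False)) A @ map (\<lambda>k. (k, True)) B"
    "length A = eps n i w"
    "f_rec n i w = (case B of [] \<Rightarrow> None | k # _ \<Rightarrow> Some (w[k := f_letter n i (w ! k)]))"
    by blast
  have rem: "map (apfst Suc) (remaining n i w) =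
      map (\<lambda>k. (k, False)) (map Suc A) @ map (\<lambda>k. (k, True)) (map Suc B)"
    by (simp add: AB)
  have shift: "map_option ((#) x) (f_rec n i w) =
      (case map Suc B of [] \<Rightarrow> None | k # _ \<Rightarrow> Some ((x # w)[k := f_letter n i ((x # w) ! k)]))"
    by (cases B) (simp_all add: AB(3))
  consider (paired) a A' where "x \<in> plus_letters n i" "A = a # A'"
    | (plus) "x \<in> plus_letters n i" "A = []"
    | (minus) "x \<notin> plus_letters n i" "x \<in> minus_letters n i"
    | (other) "x \<notin> plus_letters n i" "x \<notin> minus_letters n i"
    by (cases A) auto
  then show ?case
  proof cases
    case paired
    then show ?thesis
      using AB(2) shift rem
      by (intro exI[of _ "map Suc A'"] exI[of _ "map Suc B"]) (auto simp: remaining_Cons)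
  next
    case plus
    then show ?thesis
      using AB(2) rem
      by (intro exI[of _ "[]"] exI[of _ "0 # map Suc B"]) (cases B; auto simp: remaining_Cons)
  next
    case minus
    then show ?thesis
      using AB(2) shift rem
      by (intro exI[of _ "0 # map Suc A"] exI[of _ "map Suc B"]) (auto simp: remaining_Cons)
  next
    case other
    then show ?thesis
      using AB(2) shift rem
      by (intro exI[of _ "map Suc A"] exI[of _ "map Suc B"]) (auto simp: remaining_Cons)
  qed
qed

lemma f_op_eq_f_rec: "f_op n i w = f_rec n i w"
proof -
  obtain A B where AB: "remaining n i w = map (\<lambda>k. (k, False)) A @ map (\<lambda>k. (k, True)) B"
    "f_rec n i w = (case B of [] \<Rightarrow> None | k # _ \<Rightarrow> Some (w[k := f_letter n i (w ! k)]))"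
    using remaining_f_rec by blast
  have "filter snd (remaining n i w) = map (\<lambda>k. (k, True)) B"
    by (simp add: AB(1) filter_map o_def)
  then show ?thesis
    by (simp add: f_op_def AB(2) split: list.split)
qed

section \<open>Splitting a word at the letter that an operator changes\<close>

lemma minus_not_plus: "m \<in> minus_letters n i \<Longrightarrow> m \<notin> plus_letters n i"
  by (auto simp: plus_letters_def minus_letters_def split: if_splits)

text \<open>\<open>f_rec n i ys = None\<close> means that \<open>ys\<close> has no unpaired +, so
  nothing in \<open>ys\<close> can delete a - of \<open>zs\<close>.\<close>

lemma eps_append: "f_rec n i ys = None \<Longrightarrow> eps n i (ys @ zs) = eps n i ys + eps n i zs"
  by (induction ys) (auto split: if_splits)

lemma f_rec_append:
  assumes "f_rec n i ys = None" "x \<in> plus_letters n i" "eps n i zs = 0"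
  shows "f_rec n i (ys @ x # zs) = Some (ys @ f_letter n i x # zs)"
  using assms(1)
proof (induction ys)
  case (Cons y ys)
  then show ?case using assms(2,3) by (auto simp: eps_append split: if_splits)
qed (use assms(2,3) in auto)

text \<open>The changed letter is the leftmost unpaired +, so none lies in \<open>ys\<close>; an
  unpaired - in \<open>zs\<close> would have been paired with it.\<close>

lemma f_rec_SomeD:
  assumes "f_rec n i w = Some b"
  shows "\<exists>ys x zs. w = ys @ x # zs \<and> b = ys @ f_letter n i x # zs \<and> x \<in> plus_letters n i \<and>
    eps n i zs = 0 \<and> f_rec n i ys = None"
  using assms
proof (induction w arbitrary: b)
  case (Cons y w)
  show ?case
  proof (cases "y \<in> plus_letters n i \<and> eps n i w = 0")
    case True
    then show ?thesis using Cons.prems by (intro exI[of _ "[]"]) auto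
  next
    case False
    with Cons.prems obtain b' where b': "f_rec n i w = Some b'" "b = y # b'" by auto
    with Cons.IH obtain ys x zs where *: "w = ys @ x # zs" "b' = ys @ f_letter n i x # zs"
      "x \<in> plus_letters n i" "eps n i zs = 0" "f_rec n i ys = None"
      by blast
    then have "f_rec n i (y # ys) = None"
      using False by (auto simp: eps_append)
    with * b' show ?thesis by (metis append_Cons)
  qed
qed simp

text \<open>\<open>m\<close> is the rightmost unpaired -, the letter that the raising operator
  changes. An unpaired + in \<open>ys\<close> would have been paired with it.\<close>

lemma eps_pos_split:
  assumes "eps n i w > 0"
  shows "\<exists>ys m zs. w = ys @ m # zs \<and> m \<in> minus_letters n i \<and> eps n i zs = 0 \<and> f_rec n i ys = None"
  using assms
proof (induction w)
  case (Cons y w)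
  show ?case
  proof (cases "eps n i w = 0")
    case True
    then show ?thesis
      using Cons.prems by (intro exI[of _ "[]"]) (auto split: if_splits)
  next
    case False
    with Cons.IH obtain ys m zs where *: "w = ys @ m # zs" "m \<in> minus_letters n i"
      "eps n i zs = 0" "f_rec n i ys = None"
      by blast
    \<comment> \<open>\<open>m # zs\<close> contributes exactly one unpaired -. If \<open>y\<close>
      is a + and an unpaired - still remains, then \<open>ys\<close> has one for \<open>y\<close> to
      delete.\<close>
    then have "eps n i w \<le> Suc (eps n i ys)"
      by (simp add: eps_append)
    then have "f_rec n i (y # ys) = None"
      using Cons.prems *(4) by (auto split: if_splits)
    with * show ?thesis by (metis append_Cons)
  qed
qed simp

text \<open>A final + has no - after it to be paired with.\<close>

lemma f_rec_None_last: "f_rec n i ys = None \<Longrightarrow> ys \<noteq> [] \<Longrightarrow> last ys \<notin> plus_letters n i"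
  by (induction ys) (auto split: if_splits)

text \<open>No - is left unpaired, so \<open>q\<close> is paired, necessarily with a + before
  it.\<close>

lemma eps_zero_plus_before:
  assumes "eps n i (z1 @ q # z2) = 0" "q \<in> minus_letters n i"
  shows "\<exists>x\<in>set z1. x \<in> plus_letters n i"
proof (rule ccontr)
  assume no: "\<not> ?thesis"
  have "q \<notin> plus_letters n i"
    using assms(2) by (rule minus_not_plus)
  then have "eps n i (q # z2) > 0" using assms(2) by simp
  moreover have "eps n i (z1 @ q # z2) \<ge> eps n i (q # z2)"
    using no by (induction z1) auto
  ultimately show False using assms(1) by simp
qed

section \<open>Raising and lowering a single letter\<close>

fun e_letter :: "nat \<Rightarrow> nat \<Rightarrow> letter \<Rightarrow> letter" where
  "e_letter n i (Unbarred j) = Unbarred i"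
| "e_letter n i (Barred j) = (if i = n then Unbarred n else Barred (Suc i))"

lemma e_f_letter: "x \<in> plus_letters n i \<Longrightarrow> e_letter n i (f_letter n i x) = x"
  by (auto simp: plus_letters_def split: if_splits)

lemma f_e_letter: "m \<in> minus_letters n i \<Longrightarrow> f_letter n i (e_letter n i m) = m"
  by (auto simp: minus_letters_def split: if_splits)

lemma e_letter_plus: "m \<in> minus_letters n i \<Longrightarrow> e_letter n i m \<in> plus_letters n i"
  by (auto simp: plus_letters_def minus_letters_def split: if_splits)

lemma f_letter_minus: "x \<in> plus_letters n i \<Longrightarrow> f_letter n i x \<in> minus_letters n i"
  by (auto simp: plus_letters_def minus_letters_def split: if_splits)

lemma less_letter_simps [simp]:
  "Unbarred i < Unbarred j \<longleftrightarrow> i < j" "Unbarred i < Barred j"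
  "\<not> Barred i < Unbarred j" "Barred i < Barred j \<longleftrightarrow> j < i"
  by (auto simp: less_letter_def)

lemma e_letter_less: "m \<in> minus_letters n i \<Longrightarrow> e_letter n i m < m"
  by (auto simp: minus_letters_def split: if_splits)

text \<open>For \<open>i\<close> in \<open>{1..n}\<close>, raising moves \<open>m\<close> to its
  immediate predecessor in the alphabet.\<close>

lemma e_letter_greatest:
  "m \<in> minus_letters n i \<Longrightarrow> y < m \<Longrightarrow> y \<noteq> e_letter n i m \<Longrightarrow> y \<in> alphabet n \<Longrightarrow> y < e_letter n i m"
  by (cases y) (auto simp: minus_letters_def alphabet_def split: if_splits)

lemma f_letter_least:
  "x \<in> plus_letters n i \<Longrightarrow> x < y \<Longrightarrow> y \<noteq> f_letter n i x \<Longrightarrow> y \<in> alphabet n \<Longrightarrow> f_letter n i x < y"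
  by (cases y) (auto simp: plus_letters_def alphabet_def split: if_splits)

lemma e_letter_alphabet:
  "m \<in> minus_letters n i \<Longrightarrow> i \<in> {1..n} \<Longrightarrow> e_letter n i m \<in> alphabet n"
  by (auto simp: minus_letters_def alphabet_def split: if_splits)


section \<open>Columns\<close>

text \<open>Strictness could break only if the letter just above \<open>m\<close> were the
  predecessor of \<open>m\<close>; that letter is marked + and is excluded by the assumption
  \<open>last\<close>.\<close>

lemma column_e_letter:
  assumes "sorted_wrt (<) (c1 @ m # c2)" "set c1 \<subseteq> alphabet n" "m \<in> minus_letters n i"
    and last: "c1 \<noteq> [] \<Longrightarrow> last c1 \<notin> plus_letters n i"
  shows "sorted_wrt (<) (c1 @ e_letter n i m # c2)"
proof -
  have m: "y < m" if "y \<in> set c1" for y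
    using assms(1) that by (auto simp: sorted_wrt_append)
  have "y < e_letter n i m" if y: "y \<in> set c1" for y
  proof -
    have ne: "c1 \<noteq> []" using y by auto
    then have "last c1 \<noteq> e_letter n i m"
      using last e_letter_plus[OF assms(3)] by auto
    with ne have l: "last c1 < e_letter n i m"
      using e_letter_greatest[OF assms(3)] m assms(2) by (meson last_in_set subsetD)
    have "y \<le> last c1"
      using assms(1) y ne
      by (cases c1 rule: rev_cases) (auto simp: sorted_wrt_append)
    with l show ?thesis by order
  qed
  moreover have "e_letter n i m < y" if "y \<in> set c2" for y
    using assms(1) that e_letter_less[OF assms(3)] by (fastforce simp: sorted_wrt_append)
  ultimately show ?thesis
    using assms(1) by (auto simp: sorted_wrt_append)
qed

text \<open>Mirror image: the only obstruction is the successor of \<open>x\<close> directly below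
  it, a letter marked -.\<close>

lemma column_f_letter:
  assumes "sorted_wrt (<) (c1 @ x # c2)" "set c2 \<subseteq> alphabet n" "x \<in> plus_letters n i"
    and first: "c2 \<noteq> [] \<Longrightarrow> hd c2 \<notin> minus_letters n i"
  shows "sorted_wrt (<) (c1 @ f_letter n i x # c2)"
proof -
  have x: "x < y" if "y \<in> set c2" for y
    using assms(1) that by (auto simp: sorted_wrt_append)
  have lt: "x < f_letter n i x"
    using e_letter_less[OF f_letter_minus[OF assms(3)]] e_f_letter[OF assms(3)] by simp
  have "f_letter n i x < y" if y: "y \<in> set c2" for y
  proof -
    have ne: "c2 \<noteq> []" using y by auto
    then have "hd c2 \<noteq> f_letter n i x"
      using first f_letter_minus[OF assms(3)] by auto
    with ne have l: "f_letter n i x < hd c2"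
      using f_letter_least[OF assms(3)] x assms(2) by (meson hd_in_set subsetD)
    have "hd c2 \<le> y"
      using assms(1) y ne by (cases c2) (auto simp: sorted_wrt_append)
    with l show ?thesis by order
  qed
  moreover have "y < f_letter n i x" if "y \<in> set c1" for y
    using assms(1) that lt by (fastforce simp: sorted_wrt_append)
  ultimately show ?thesis
    using assms(1) by (auto simp: sorted_wrt_append)
qed

section \<open>Products of two strictly increasing words\<close>

definition two_columns :: "word \<Rightarrow> bool" where
  "two_columns w \<longleftrightarrow> (\<exists>C D. w = C @ D \<and> sorted_wrt (<) C \<and> sorted_wrt (<) D)"

lemma append_eq_split:
  assumes "C @ D = ys @ x # zs"
  obtains c where "C = ys @ x # c" "zs = c @ D" | c where "D = c @ x # zs" "ys = C @ c"
  using assms by (fastforce simp: append_eq_append_conv2 append_eq_Cons_conv Cons_eq_append_conv)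

text \<open>A letter changed by a crystal operator is not paired with its neighbours, so that a
  strictly increasing factor of the word stays strictly increasing; admissibility plays no role
  here.\<close>

lemma two_columns_arrow:
  assumes "arrow n i a b"
  shows "two_columns a \<longleftrightarrow> two_columns b"
proof -
  from assms obtain ys x zs where s: "a = ys @ x # zs" "b = ys @ f_letter n i x # zs"
    "x \<in> plus_letters n i" "eps n i zs = 0" "f_rec n i ys = None"
    unfolding arrow_def f_op_eq_f_rec using f_rec_SomeD by blast
  let ?m = "f_letter n i x"
  have m: "?m \<in> minus_letters n i" "e_letter n i ?m = x"
    using s(3) f_letter_minus e_f_letter by auto
  have alph: "set ys \<subseteq> alphabet n" "set zs \<subseteq> alphabet n"
    using assms s(1) by (auto simp: arrow_def words_def)
  have last: "last c \<notin> plus_letters n i" if "ys = c' @ c" "c \<noteq> []" for c c'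
    using f_rec_None_last[OF s(5)] that by auto
  \<comment> \<open>With \<open>z1 = []\<close>: a - at the start of \<open>zs\<close> would have no
    + before it and stay unpaired.\<close>
  have first: "hd c \<notin> minus_letters n i" if "zs = c @ c'" "c \<noteq> []" for c c'
    using eps_zero_plus_before[of n i "[]" "hd c" "tl c @ c'"] s(4) that by (cases c) auto
  show ?thesis
  proof
    assume "two_columns a"
    then obtain C D where CD: "C @ D = ys @ x # zs" "sorted_wrt (<) C" "sorted_wrt (<) D"
      by (auto simp: two_columns_def s(1))
    from CD(1) show "two_columns b"
    proof (rule append_eq_split)
      fix c assume c: "C = ys @ x # c" "zs = c @ D"
      have "sorted_wrt (<) (ys @ ?m # c)"
        using column_f_letter[of ys x c n i] CD(2) c alph s(3) first[of c D] by auto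
      then show ?thesis
        using c CD(3) s(2) unfolding two_columns_def by (metis append.assoc append_Cons)
    next
      fix c assume c: "D = c @ x # zs" "ys = C @ c"
      have "sorted_wrt (<) (c @ ?m # zs)"
        using column_f_letter[of c x zs n i] CD(3) c alph s(3) first[of zs "[]"] by auto
      then show ?thesis
        using c CD(2) s(2) unfolding two_columns_def by (metis append.assoc)
    qed
  next
    assume "two_columns b"
    then obtain C D where CD: "C @ D = ys @ ?m # zs" "sorted_wrt (<) C" "sorted_wrt (<) D"
      by (auto simp: two_columns_def s(2))
    from CD(1) show "two_columns a"
    proof (rule append_eq_split)
      fix c assume c: "C = ys @ ?m # c" "zs = c @ D"
      have "sorted_wrt (<) (ys @ x # c)"
        using column_e_letter[of ys ?m c n i] CD(2) c alph m last[of "[]" ys] by auto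
      then show ?thesis
        using c CD(3) s(1) unfolding two_columns_def by (metis append.assoc append_Cons)
    next
      fix c assume c: "D = c @ ?m # zs" "ys = C @ c"
      have "sorted_wrt (<) (c @ x # zs)"
        using column_e_letter[of c ?m zs n i] CD(3) c alph m last[of C c] by auto
      then show ?thesis
        using c CD(2) s(1) unfolding two_columns_def by (metis append.assoc)
    qed
  qed
qed

text \<open>Components are closed under arrows in both directions, which is why
  \<open>two_columns_arrow\<close> is an equivalence.\<close>

lemma two_columns_component:
  assumes "z \<in> component n w" "two_columns w"
  shows "two_columns z"
  using assms(1) unfolding component_def mem_Collect_eq
  by (induction rule: rtranclp_induct) (use assms(2) two_columns_arrow in blast)+

lemma weight_append: "weight (u @ v) i = weight u i + weight v i"
  by (simp add: weight_def)

lemma count_list_column: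
  "sorted_wrt (<) (C :: letter list) \<Longrightarrow> count_list C x = (if x \<in> set C then 1 else 0)"
  by (induction C) auto

text \<open>Each strictly increasing factor contains \<open>Unbarred i\<close> at most once.\<close>

lemma weight_two_columns: "two_columns z \<Longrightarrow> weight z i \<le> 2"
  by (auto simp: two_columns_def weight_append) (simp add: weight_def count_list_column)


section \<open>Raising symplectic tableaux\<close>

fun level :: "letter \<Rightarrow> nat" where
  "level (Unbarred i) = i"
| "level (Barred i) = i"

text \<open>For \<open>t = 1\<close> and a column these are the letters counted by N(m). The cutoff
  \<open>t\<close> will come from a top letter \<open>Unbarred t\<close>.\<close>

definition low :: "letter set \<Rightarrow> nat \<Rightarrow> nat \<Rightarrow> letter set" where
  "low S t m = {x \<in> S. t \<le> level x \<and> level x \<le> m}"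

text \<open>For a column \<open>U\<close> to the right of a column with top letter \<open>a\<close>, this is the part of the
  tableau condition that concerns the top letters: \<open>a \<le> x\<close> for all letters \<open>x\<close> of \<open>lU\<close>,
  restated without \<open>lU\<close>. For \<open>a = Unbarred 1\<close> it is admissibility.\<close>

definition right_of :: "letter set \<Rightarrow> letter \<Rightarrow> bool" where
  "right_of S a \<longleftrightarrow> (\<forall>x\<in>S. a \<le> x) \<and> (\<forall>t m. a = Unbarred t \<longrightarrow> card (low S t m) \<le> m + 1 - t)"

lemma finite_low: "finite S \<Longrightarrow> finite (low S t m)"
  by (simp add: low_def)

text \<open>Lowering the bound from \<open>t\<close> to \<open>t'\<close> adds only levels below
  \<open>t\<close>. There all letters of \<open>S\<close> are barred, because they are at least
  \<open>a\<close>, so each new level adds at most one letter. This protects a column when the top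
  letter to its left is raised.\<close>

lemma right_of_mono:
  assumes "right_of S a" "a' \<le> a" "finite S"
  shows "right_of S a'"
  unfolding right_of_def
proof (intro conjI allI impI ballI)
  show "a' \<le> x" if "x \<in> S" for x
    using assms(1,2) that by (auto simp: right_of_def intro: order_trans)
next
  fix t' m assume a': "a' = Unbarred t'"
  have bars: "card (low S t' m) \<le> m + 1 - t'" if "low S t' m \<subseteq> Barred ` {t'..m}"
  proof -
    have "card (low S t' m) \<le> card (Barred ` {t'..m})"
      using that by (intro card_mono) auto
    also have "\<dots> \<le> m + 1 - t'"
      using card_image_le[of "{t'..m}" Barred] by simp
    finally show ?thesis .
  qed
  show "card (low S t' m) \<le> m + 1 - t'"
  proof (cases a)
    case (Unbarred t)
    have tt: "t' \<le> t" using assms(2) a' Unbarred by simp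
    have S: "x = Barred (level x)" if "x \<in> S" "level x < t" for x
      using assms(1) that Unbarred by (cases x) (auto simp: right_of_def)
    show ?thesis
    proof (cases "m < t")
      case True
      then have "low S t' m \<subseteq> Barred ` {t'..m}"
        using S by (fastforce simp: low_def)
      then show ?thesis by (rule bars)
    next
      case False
      have "low S t' m \<subseteq> Barred ` {t'..<t} \<union> low S t m"
      proof
        fix x assume "x \<in> low S t' m"
        then show "x \<in> Barred ` {t'..<t} \<union> low S t m"
          using S[of x] by (cases "level x < t") (auto simp: low_def)
      qed
      then have "card (low S t' m) \<le> card (Barred ` {t'..<t} \<union> low S t m)"
        using assms(3) by (intro card_mono) (auto simp: finite_low)
      also have "\<dots> \<le> card (Barred ` {t'..<t}) + card (low S t m)"
        by (rule card_Un_le)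
      also have "\<dots> \<le> (t - t') + (m + 1 - t)"
        using assms(1) Unbarred card_image_le[of "{t'..<t}" Barred]
        by (intro add_mono) (auto simp: right_of_def)
      finally show ?thesis using False tt by simp
    qed
  next
    case (Barred s)
    then have S: "x = Barred (level x)" if "x \<in> S" for x
      using assms(1) that by (cases x) (auto simp: right_of_def)
    then show ?thesis
      by (intro bars) (fastforce simp: low_def)
  qed
qed

text \<open>The last two assumptions hold because \<open>e\<^sub>i\<close> changes the rightmost unpaired \<open>-\<close>: every
  \<open>-\<close> to its right is paired. Here \<open>a\<close> is the top letter of the column that follows in the
  reading.\<close>

lemma right_of_e_letter:
  assumes C: "sorted_wrt (<) (c1 @ m # c2)" "set (c1 @ m # c2) \<subseteq> alphabet n"
    and m: "m \<in> minus_letters n i" and i: "1 \<le> i" "i \<le> n"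
    and new: "sorted_wrt (<) (c1 @ e_letter n i m # c2)"
    and ab: "right_of (set (c1 @ m # c2)) a" "a \<in> alphabet n"
    and a: "a \<in> minus_letters n i \<Longrightarrow> \<exists>x\<in>set c2. x \<in> plus_letters n i"
    and paired: "\<And>z1 q z2. c2 = z1 @ q # z2 \<Longrightarrow> q \<in> minus_letters n i \<Longrightarrow>
      \<exists>x\<in>set z1. x \<in> plus_letters n i"
  shows "right_of (set (c1 @ e_letter n i m # c2)) a"
proof -
  define S where "S = set (c1 @ m # c2)"
  define R where "R = set (c1 @ c2)"
  define x where "x = e_letter n i m"
  have fin: "finite R" by (simp add: R_def)
  have S: "S = insert m R" "m \<notin> R"
    using C(1) by (auto simp: S_def R_def sorted_wrt_append)
  have S': "set (c1 @ e_letter n i m # c2) = insert x R" "x \<notin> R"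
    using new by (auto simp: R_def x_def sorted_wrt_append)
  have c2: "m < y" if "y \<in> set c2" for y
    using C(1) that by (auto simp: sorted_wrt_append)
  have aS: "a \<le> y" if "y \<in> S" for y
    using ab(1) that by (auto simp: right_of_def S_def)
  have aCard: "card (low S t k) \<le> k + 1 - t" if "a = Unbarred t" for t k
    using ab(1) that by (auto simp: right_of_def S_def)
  have am: "a \<le> m" using aS S(1) by auto
  have low_insert: "low (insert y R) t k = (if t \<le> level y \<and> level y \<le> k then insert y (low R t k) else low R t k)"
    for y t k by (auto simp: low_def)
  have nin: "m \<notin> low R t k" "x \<notin> low R t k" for t k
    using S(2) S'(2) by (auto simp: low_def)
  \<comment> \<open>No count grows if every window of levels containing the new letter already
    contained the old one.\<close>
  have same: "right_of (insert x R) a" if ax: "a \<le> x"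
    and lev: "\<And>t k. a = Unbarred t \<Longrightarrow> t \<le> level x \<Longrightarrow> level x \<le> k \<Longrightarrow> t \<le> level m \<and> level m \<le> k"
    unfolding right_of_def
  proof (intro conjI ballI allI impI)
    show "a \<le> y" if "y \<in> insert x R" for y using that ax aS S(1) by auto
  next
    fix t k assume t: "a = Unbarred t"
    have "card (low (insert x R) t k) \<le> card (low S t k)"
      using lev[OF t] nin fin by (auto simp: S(1) low_insert finite_low card_insert_if)
    with aCard[OF t] show "card (low (insert x R) t k) \<le> k + 1 - t"
      by (rule order_trans[rotated])
  qed
  consider (n) "i = n" "m = Barred n" | (unbarred) "i \<noteq> n" "m = Unbarred (Suc i)"
    | (barred) "i \<noteq> n" "m = Barred i"
    using m by (auto simp: minus_letters_def split: if_splits)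
  then have "right_of (insert x R) a"
  proof cases
    \<comment> \<open>The level stays \<open>n\<close>. The only threat is
      \<open>a = Barred n\<close>, but then a + lies below \<open>m\<close> in the column, although
      the only + here is \<open>Unbarred n\<close>, which is smaller than \<open>m\<close>.\<close>
    case n
    have "a \<le> x"
    proof (rule ccontr)
      assume "\<not> a \<le> x"
      then have "a = Barred n"
        using am ab(2) n by (cases a) (auto simp: x_def alphabet_def)
      then obtain y where "y \<in> set c2" "y \<in> plus_letters n i"
        using a n by (auto simp: minus_letters_def)
      then show False using c2 n by (fastforce simp: plus_letters_def)
    qed
    then show ?thesis by (rule same) (use n in \<open>auto simp: x_def\<close>)
  next
    \<comment> \<open>The level rises from \<open>i\<close> to \<open>Suc i\<close>. No + is larger
      than \<open>Barred i\<close>, so \<open>a\<close> is not marked -; this gives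
      \<open>a \<le> x\<close> and rules out a window starting at \<open>Suc i\<close>.\<close>
    case barred
    have no: "y \<notin> plus_letters n i" if "y \<in> set c2" for y
      using c2[OF that] barred by (cases y) (auto simp: plus_letters_def)
    then have am': "a \<notin> minus_letters n i" using a by blast
    then have "a \<le> x"
      using am barred by (cases a) (auto simp: x_def minus_letters_def le_less)
    moreover have "a \<noteq> Unbarred (Suc i)"
      using am' barred by (auto simp: minus_letters_def)
    ultimately show ?thesis
      by (intro same) (use barred in \<open>auto simp: x_def le_Suc_eq\<close>)
  next
    \<comment> \<open>The level drops from \<open>Suc i\<close> to \<open>i\<close>, so only windows
      ending at \<open>i\<close> can gain a letter.\<close>
    case unbarred
    have pl: "y = Barred (Suc i)" if "y \<in> set c2" "y \<in> plus_letters n i" for y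
      using c2[OF that(1)] that(2) unbarred by (auto simp: plus_letters_def)
    from am unbarred obtain t where t: "a = Unbarred t" "t \<le> Suc i"
      by (cases a) auto
    have both: "card (low S t (Suc i)) \<ge> card (low S t i) + 2"
      if B: "Barred (Suc i) \<in> set c2"
    proof -
      have "low S t (Suc i) \<supseteq> low S t i \<union> {Unbarred (Suc i), Barred (Suc i)}"
        using B unbarred t by (auto simp: low_def S_def)
      then have "card (low S t i \<union> {Unbarred (Suc i), Barred (Suc i)}) \<le> card (low S t (Suc i))"
        by (intro card_mono) (auto simp: low_def S_def)
      moreover have "card (low S t i \<union> {Unbarred (Suc i), Barred (Suc i)}) = card (low S t i) + 2"
        by (subst card_Un_disjoint) (auto simp: low_def S_def)
      ultimately show ?thesis by simp
    qed
    \<comment> \<open>If \<open>t = Suc i\<close>, then \<open>a\<close> is marked - and forces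
      \<open>Barred (Suc i)\<close> into the column, giving two letters in a window of one
      level.\<close>
    have ti: "t \<le> i"
    proof (rule ccontr)
      assume "\<not> t \<le> i"
      then have t': "t = Suc i" using t by simp
      then have "Barred (Suc i) \<in> set c2"
        using a t pl unbarred by (fastforce simp: minus_letters_def)
      from both[OF this] aCard[OF t(1), of "Suc i"] t' show False by simp
    qed
    have x: "x = Unbarred i" using unbarred by (simp add: x_def)
    have "card (low (insert x R) t k) \<le> k + 1 - t" for k
    proof (cases "k = i")
      case False
      have "card (low (insert x R) t k) \<le> card (low S t k)"
        using False nin fin ti unbarred x
        by (auto simp: S(1) low_insert finite_low card_insert_if)
      with aCard[OF t(1)] show ?thesis by (rule order_trans[rotated])
    next
      case True
      show ?thesis
      proof (cases "Barred i \<in> set c2")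
        \<comment> \<open>The - at \<open>Barred i\<close> is paired with a + inside the column,
          which can only be \<open>Barred (Suc i)\<close>. Level \<open>Suc i\<close> then holds two
          letters, so the bound for the window up to \<open>Suc i\<close> leaves room for one more
          letter up to \<open>i\<close>.\<close>
        case B: True
        then obtain z1 z2 where z: "c2 = z1 @ Barred i # z2" by (meson split_list)
        with paired[OF z] unbarred have "\<exists>y\<in>set z1. y \<in> plus_letters n i"
          by (auto simp: minus_letters_def)
        then have "Barred (Suc i) \<in> set c2" using pl z by auto
        from both[OF this] aCard[OF t(1), of "Suc i"]
        have "card (low S t i) + 2 \<le> Suc i + 1 - t" by simp
        moreover have "low (insert x R) t i = insert x (low S t i)"
          using x ti unbarred by (auto simp: S(1) low_insert)
        ultimately show ?thesis
          using True ti card_insert_le_m1[of "Suc (card (low S t i))" "low S t i" x] by simp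
      next
        \<comment> \<open>Level \<open>i\<close> holds no letter before the change, so the bound for
          the window up to \<open>i - 1\<close> suffices.\<close>
        case B: False
        have "Barred i \<notin> set c1"
          using C(1) unbarred by (auto simp: sorted_wrt_append)
        then have "low (insert x R) t i \<subseteq> insert x (low S t (i - 1))"
        proof -
          have "Barred i \<notin> R" using B by (simp add: R_def \<open>Barred i \<notin> set c1\<close>)
          then have "level y \<noteq> i" if "y \<in> R" for y
            using that S'(2) x by (cases y) auto
          then show ?thesis by (fastforce simp: low_def S(1))
        qed
        then have "card (low (insert x R) t i) \<le> card (insert x (low S t (i - 1)))"
          by (intro card_mono) (auto simp: low_def S_def)
        also have "\<dots> \<le> Suc (card (low S t (i - 1)))" by (rule card_insert_le_m1) auto
        finally show ?thesis
          using aCard[OF t(1), of "i - 1"] True ti i by simp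
      qed
    qed
    moreover have "a \<le> y" if "y \<in> insert x R" for y
      using that aS S(1) t x ti by auto
    ultimately show ?thesis
      using t by (auto simp: right_of_def)
  qed
  then show ?thesis unfolding S'(1) .
qed

section \<open>Raising tableaux that satisfy the top letter condition\<close>

text \<open>Columns are listed here in the order of the reading, the rightmost column first.\<close>

fun next_top :: "letter list list \<Rightarrow> letter" where
  "next_top [] = Unbarred 1"
| "next_top (C # Cs) = hd C"

text \<open>The leftmost column comes last and has no left neighbour; the default
  \<open>Unbarred 1\<close> of \<open>next_top\<close> turns its condition into
  admissibility.\<close>

fun top_tableau :: "nat \<Rightarrow> letter list list \<Rightarrow> bool" where
  "top_tableau n [] \<longleftrightarrow> True"
| "top_tableau n (C # Cs) \<longleftrightarrow> C \<noteq> [] \<and> sorted_wrt (<) C \<and> set C \<subseteq> alphabet n \<and>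
     right_of (set C) (next_top Cs) \<and> top_tableau n Cs"

lemma next_top_alphabet: "top_tableau n Cs \<Longrightarrow> 1 \<le> n \<Longrightarrow> next_top Cs \<in> alphabet n"
  using hd_in_set[of "hd Cs"] by (cases Cs) (simp add: alphabet_def, auto)

lemma top_tableau_words: "top_tableau n Cs \<Longrightarrow> concat Cs \<in> words n"
  by (induction Cs) (auto simp: words_def)

text \<open>The column containing \<open>m\<close> is handled by \<open>right_of_e_letter\<close>.
  Its own top can only decrease, so the column to its right is handled by
  \<open>right_of_mono\<close>; hence the inequality of tops in the induction.\<close>

lemma top_tableau_e_letter:
  assumes "top_tableau n Cs" "concat Cs = ys @ m # zs" "m \<in> minus_letters n i" "i \<in> {1..n}"
    and "ys \<noteq> [] \<Longrightarrow> last ys \<notin> plus_letters n i" "eps n i zs = 0"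
  shows "\<exists>Cs'. top_tableau n Cs' \<and> concat Cs' = ys @ e_letter n i m # zs \<and>
    next_top Cs' \<le> next_top Cs \<and> length Cs' = length Cs"
  using assms(1,2,5)
proof (induction Cs arbitrary: ys)
  case Nil
  then show ?case by simp
next
  case (Cons C Cs)
  have C: "C \<noteq> []" "sorted_wrt (<) C" "set C \<subseteq> alphabet n"
    "right_of (set C) (next_top Cs)" "top_tableau n Cs"
    using Cons.prems(1) by auto
  have "C @ concat Cs = ys @ m # zs" using Cons.prems(2) by simp
  then show ?case
  proof (rule append_eq_split)
    fix c assume c: "C = ys @ m # c" "zs = c @ concat Cs"
    have sorted: "sorted_wrt (<) (ys @ e_letter n i m # c)"
      using column_e_letter[of ys m c n i] C(2,3) c assms(3) Cons.prems(3) by auto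
    \<comment> \<open>The next top directly follows \<open>c\<close> in the reading. If it is a -,
      it is paired with a + in \<open>c\<close>. The default \<open>Unbarred 1\<close> is never a -,
      as \<open>i\<close> is positive.\<close>
    have top: "\<exists>x\<in>set c. x \<in> plus_letters n i" if a: "next_top Cs \<in> minus_letters n i"
    proof -
      have "Cs \<noteq> []"
        using a assms(4) by (auto simp: minus_letters_def split: if_splits)
      then obtain D Ds where "Cs = D # Ds" by (cases Cs) auto
      with a C(5) have "zs = c @ next_top Cs # (tl D @ concat Ds)"
        using c(2) by (cases D) auto
      then show ?thesis using eps_zero_plus_before assms(6) a by metis
    qed
    have "right_of (set (ys @ e_letter n i m # c)) (next_top Cs)"
    proof (rule right_of_e_letter[where n = n])
      show "\<exists>x\<in>set z1. x \<in> plus_letters n i"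
        if "c = z1 @ q # z2" "q \<in> minus_letters n i" for z1 q z2
        using eps_zero_plus_before[of n i z1 q "z2 @ concat Cs"] that assms(6) c(2) by simp
    qed (use C c sorted assms(3,4) top next_top_alphabet in auto)
    moreover have "e_letter n i m \<in> alphabet n"
      using e_letter_alphabet assms(3,4) by simp
    moreover have "hd (ys @ e_letter n i m # c) \<le> hd C"
      using e_letter_less[OF assms(3)] c(1) by (cases ys) auto
    ultimately show ?thesis
      using C c sorted by (intro exI[of _ "(ys @ e_letter n i m # c) # Cs"]) auto
  next
    fix c assume c: "concat Cs = c @ m # zs" "ys = C @ c"
    then have "c \<noteq> [] \<Longrightarrow> last c \<notin> plus_letters n i" using Cons.prems(3) by auto
    from Cons.IH[OF C(5) c(1) this] obtain Cs' where Cs': "top_tableau n Cs'"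
      "concat Cs' = c @ e_letter n i m # zs" "next_top Cs' \<le> next_top Cs" "length Cs' = length Cs"
      by blast
    moreover have "right_of (set C) (next_top Cs')"
      using right_of_mono[OF C(4) Cs'(3)] by simp
    ultimately show ?thesis
      using C c by (intro exI[of _ "C # Cs'"]) auto
  qed
qed

text \<open>The position of a letter in the ordered alphabet, counted from 1. Its sum over a word
  measures the progress of raising.\<close>

fun rank :: "nat \<Rightarrow> letter \<Rightarrow> nat" where
  "rank n (Unbarred i) = i"
| "rank n (Barred i) = 2 * n + 1 - i"

lemma rank_e_letter: "m \<in> minus_letters n i \<Longrightarrow> i \<in> {1..n} \<Longrightarrow> rank n (e_letter n i m) < rank n m"
  by (auto simp: minus_letters_def split: if_splits)

lemma minus_letter_exists:
  assumes "x \<in> alphabet n" "x \<noteq> Unbarred 1"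
  obtains i where "i \<in> {1..n}" "x \<in> minus_letters n i"
proof (cases x)
  case (Unbarred j)
  then have "j - 1 \<in> {1..n}" "x \<in> minus_letters n (j - 1)"
    using assms by (auto simp: alphabet_def minus_letters_def)
  then show ?thesis by (rule that)
next
  case (Barred j)
  then have "j \<in> {1..n}" "x \<in> minus_letters n j"
    using assms by (auto simp: alphabet_def minus_letters_def)
  then show ?thesis by (rule that)
qed

text \<open>A first letter other than \<open>Unbarred 1\<close> is a - for some \<open>i\<close>,
  and nothing before it can be paired with it. So some raising operator applies until the first
  letter is 1.\<close>

lemma raise_to_top:
  assumes "top_tableau n Cs" "1 \<le> n"
  shows "\<exists>Cs'. top_tableau n Cs' \<and> length Cs' = length Cs \<and> next_top Cs' = Unbarred 1 \<and>
    concat Cs' \<in> component n (concat Cs)"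
  using assms(1)
proof (induction "sum_list (map (rank n) (concat Cs))" arbitrary: Cs rule: less_induct)
  case less
  show ?case
  proof (cases "next_top Cs = Unbarred 1")
    case True
    then show ?thesis using less.prems by (auto simp: component_def)
  next
    case False
    with next_top_alphabet[OF less.prems assms(2)] obtain i
      where i: "i \<in> {1..n}" "next_top Cs \<in> minus_letters n i"
      by (rule minus_letter_exists)
    have "Cs \<noteq> []" using False by auto
    then obtain w where "concat Cs = next_top Cs # w"
      using less.prems by (cases Cs) (auto simp: neq_Nil_conv)
    then have "eps n i (concat Cs) > 0"
      using i(2) minus_not_plus by simp
    \<comment> \<open>The letter \<open>m\<close> that is raised need not be the first one, but each
      raise lowers the sum of ranks.\<close>
    then obtain ys m zs where s: "concat Cs = ys @ m # zs" "m \<in> minus_letters n i"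
      "eps n i zs = 0" "f_rec n i ys = None"
      using eps_pos_split by blast
    with top_tableau_e_letter[OF less.prems s(1,2) i(1) f_rec_None_last[OF s(4)] s(3)]
    obtain Cs' where Cs': "top_tableau n Cs'" "concat Cs' = ys @ e_letter n i m # zs"
      "length Cs' = length Cs"
      by blast
    have "f_op n i (concat Cs') = Some (concat Cs)"
      using f_rec_append[OF s(4) e_letter_plus[OF s(2)] s(3)] Cs'(2) s(1) f_e_letter[OF s(2)]
      by (simp add: f_op_eq_f_rec)
    then have arrow: "arrow n i (concat Cs') (concat Cs)"
      using i(1) top_tableau_words Cs'(1) less.prems by (auto simp: arrow_def)
    have "sum_list (map (rank n) (concat Cs')) < sum_list (map (rank n) (concat Cs))"
      unfolding s(1) Cs'(2) using rank_e_letter[OF s(2) i(1)] by simp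
    from less.hyps[OF this Cs'(1)] Cs'(3) obtain Ds where Ds: "top_tableau n Ds" "length Ds = length Cs"
      "next_top Ds = Unbarred 1" "concat Ds \<in> component n (concat Cs')"
      by auto
    from Ds(4) arrow have "concat Ds \<in> component n (concat Cs)"
      unfolding component_def mem_Collect_eq
      by (blast intro: converse_rtranclp_into_rtranclp)
    with Ds show ?thesis by blast
  qed
qed

text \<open>A top equal to 1 forces the next top to be 1, so all tops are 1. The bound with
  \<open>t = m = 1\<close> then excludes \<open>Barred 1\<close>, and each column contributes
  exactly 1.\<close>

lemma top_tableau_weight:
  assumes "top_tableau n Cs" "1 \<le> n" "next_top Cs = Unbarred 1"
  shows "weight (concat Cs) 1 = int (length Cs)"
  using assms(1,3)
proof (induction Cs)
  case Nil
  show ?case by (simp add: weight_def)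
next
  case (Cons C Cs)
  have C: "C \<noteq> []" "sorted_wrt (<) C" "hd C = Unbarred 1"
    "right_of (set C) (next_top Cs)" "top_tableau n Cs"
    using Cons.prems by auto
  have in1: "Unbarred 1 \<in> set C" using C(1,3) hd_in_set by metis
  then have "next_top Cs \<le> Unbarred 1" using C(4) by (auto simp: right_of_def)
  then have top: "next_top Cs = Unbarred 1"
    using next_top_alphabet[OF C(5) assms(2)] by (cases "next_top Cs") (auto simp: alphabet_def)
  have "Barred 1 \<notin> set C"
  proof
    assume "Barred 1 \<in> set C"
    then have "{Unbarred 1, Barred 1} \<subseteq> low (set C) 1 1"
      using in1 by (auto simp: low_def)
    then have "card {Unbarred 1, Barred 1} \<le> card (low (set C) 1 1)"
      by (intro card_mono) (auto simp: finite_low)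
    moreover have "card (low (set C) 1 1) \<le> 1 + 1 - 1"
      using C(4) top unfolding right_of_def by blast
    ultimately show False by simp
  qed
  then have "weight C 1 = 1"
    using in1 by (simp add: weight_def count_list_column[OF C(2)])
  then show ?case using Cons.IH[OF C(5) top] by (simp add: weight_append)
qed


section \<open>The tableau condition on the top letters\<close>

text \<open>The set I of the column.\<close>

definition doubles :: "letter list \<Rightarrow> nat set" where
  "doubles U = {x. Unbarred x \<in> set U \<and> Barred x \<in> set U}"

text \<open>The pool from which J is chosen. It is infinite, so it is counted only within bounded
  intervals.\<close>

definition gaps :: "letter list \<Rightarrow> nat set" where
  "gaps U = {z. 1 \<le> z \<and> Unbarred z \<notin> set U \<and> Barred z \<notin> set U}"

lemma finite_doubles: "finite (doubles U)"
proof -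
  have "doubles U \<subseteq> level ` set U" by (force simp: doubles_def)
  then show ?thesis by (rule finite_subset) simp
qed

text \<open>Each level of the window carries two letters, one or none. Thus the bound in
  \<open>right_of\<close> says that the window has at least as many gaps as doubles.\<close>

lemma card_low:
  assumes "1 \<le> t"
  shows "card (low (set U) t m) + card (gaps U \<inter> {t..m}) = (m + 1 - t) + card (doubles U \<inter> {t..m})"
proof -
  define A where "A = {z\<in>{t..m}. Unbarred z \<in> set U}"
  define B where "B = {z\<in>{t..m}. Barred z \<in> set U}"
  have fin: "finite A" "finite B" by (auto simp: A_def B_def)
  have "x \<in> low (set U) t m \<longleftrightarrow> x \<in> Unbarred ` A \<union> Barred ` B" for x
    by (cases x) (auto simp: low_def A_def B_def)
  then have "low (set U) t m = Unbarred ` A \<union> Barred ` B" by blast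
  then have "card (low (set U) t m) = card (Unbarred ` A) + card (Barred ` B)"
    using fin by (simp only:) (intro card_Un_disjoint; auto)
  also have "\<dots> = card A + card B"
    by (simp add: card_image inj_on_def)
  also have "\<dots> = card (A \<union> B) + card (A \<inter> B)"
    using fin by (rule card_Un_Int)
  also have "A \<inter> B = doubles U \<inter> {t..m}"
    by (auto simp: A_def B_def doubles_def)
  finally have "card (low (set U) t m) = card (A \<union> B) + card (doubles U \<inter> {t..m})" .
  moreover have "card (A \<union> B) + card (gaps U \<inter> {t..m}) = card {t..m}"
  proof (subst card_Un_disjoint[symmetric])
    have "A \<union> B \<union> gaps U \<inter> {t..m} = {t..m}"
      using assms by (auto simp: A_def B_def gaps_def)
    then show "card (A \<union> B \<union> gaps U \<inter> {t..m}) = card {t..m}" by simp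
  qed (auto simp: A_def B_def gaps_def)
  ultimately show ?thesis by simp
qed

text \<open>The assumptions are a Hall condition: they keep the sets whose maxima are taken nonempty.\<close>

lemma greedy_correct:
  assumes "length xs \<le> card (gaps U \<inter> {..<y})"
    and "\<And>us x vs. xs = us @ x # vs \<Longrightarrow> length (x # vs) \<le> card (gaps U \<inter> {..<x})"
  shows "length (greedy U y xs) = length xs \<and> set (greedy U y xs) \<subseteq> gaps U \<inter> {..<y} \<and>
    distinct (greedy U y xs) \<and> list_all2 (<) (greedy U y xs) xs"
  using assms
proof (induction xs arbitrary: y)
  case Nil
  then show ?case by simp
next
  case (Cons x xs)
  define G where "G = gaps U \<inter> {..<min y x}"
  define y' where "y' = Max G"
  have greedy: "greedy U y (x # xs) = y' # greedy U y' xs"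
  proof -
    have "{z. 1 \<le> z \<and> z < min y x \<and> Unbarred z \<notin> set U \<and> Barred z \<notin> set U} = G"
      by (auto simp: G_def gaps_def)
    then show ?thesis by (simp only: greedy.simps Let_def y'_def)
  qed
  have "Suc (length xs) \<le> card G"
    using Cons.prems(1) Cons.prems(2)[of "[]" x xs] by (simp add: G_def min_def)
  moreover have fin: "finite G" by (simp add: G_def)
  ultimately have "y' \<in> G"
    unfolding y'_def by (intro Max_in) auto
  \<comment> \<open>As \<open>y'\<close> is the maximum of \<open>G\<close>, choosing it costs a
    single candidate, which matches the one entry removed from the list.\<close>
  have "gaps U \<inter> {..<y'} = G - {y'}"
  proof -
    have "z \<le> y'" if "z \<in> G" for z
      using Max_ge[OF fin that] by (simp add: y'_def)
    then show ?thesis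
      using \<open>y' \<in> G\<close> by (force simp: G_def le_less)
  qed
  then have "length xs \<le> card (gaps U \<inter> {..<y'})"
    using \<open>Suc (length xs) \<le> card G\<close> \<open>y' \<in> G\<close> fin by simp
  then have "length (greedy U y' xs) = length xs \<and> set (greedy U y' xs) \<subseteq> gaps U \<inter> {..<y'} \<and>
      distinct (greedy U y' xs) \<and> list_all2 (<) (greedy U y' xs) xs"
    by (rule Cons.IH) (metis Cons.prems(2) append_Cons)
  then show ?case
    using \<open>y' \<in> G\<close> unfolding greedy by (auto simp: G_def)
qed

lemma set_I_list: "set (I_list U) = doubles U"
  using finite_doubles[of U] by (simp add: I_list_def doubles_def)

lemma admissible_right_of:
  assumes "admissible n U"
  shows "right_of (set U) (Unbarred 1)"
  unfolding right_of_def
proof (intro conjI allI impI ballI)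
  have U: "set U \<subseteq> alphabet n" using assms by (auto simp: admissible_def is_column_def words_def)
  show "Unbarred 1 \<le> x" if "x \<in> set U" for x
    using that U by (cases x) (auto simp: alphabet_def)
  fix t m assume "Unbarred 1 = Unbarred t"
  then have t: "t = 1" by simp
  \<comment> \<open>Admissibility speaks of levels up to \<open>n\<close> only; the window up to
    \<open>m\<close> has the same letters as the one up to \<open>k\<close>.\<close>
  define k where "k = min m n"
  have low: "low (set U) 1 m = {x \<in> set U. x \<le> Unbarred k \<or> Barred k \<le> x}"
  proof -
    have "1 \<le> level x \<and> level x \<le> m \<longleftrightarrow> x \<le> Unbarred k \<or> Barred k \<le> x" if "x \<in> set U" for x
      using that U by (cases x) (auto simp: alphabet_def k_def)
    then show ?thesis by (auto simp: low_def)
  qed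
  show "card (low (set U) t m) \<le> m + 1 - t"
  proof (cases "k = 0")
    case True
    then have "low (set U) 1 m = {}"
      using U by (auto simp: low_def k_def min_def alphabet_def split: if_splits)
    then show ?thesis using t by simp
  next
    case False
    then have "k \<in> {1..n}" by (simp add: k_def)
    then have "card (low (set U) 1 m) \<le> k"
      using assms unfolding low admissible_def by blast
    then show ?thesis using t by (simp add: k_def)
  qed
qed

text \<open>The Hall condition follows from admissibility: the entries from \<open>x\<close> on are
  doubles in \<open>{1..x}\<close>, by \<open>card_low\<close> this interval has at least as many
  gaps, and \<open>x\<close> itself is not a gap.\<close>

lemma J_list_correct:
  assumes "admissible n U"
  shows "set (J_list U) \<subseteq> gaps U \<and> distinct (J_list U) \<and> list_all2 (<) (J_list U) (I_list U)"
proof (cases "I_list U")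
  case Nil
  then show ?thesis by (simp add: J_list_def)
next
  case (Cons x0 xs0)
  have desc: "sorted_wrt (>) (I_list U)"
    by (simp add: I_list_def sorted_wrt_rev)
  have U: "set U \<subseteq> alphabet n" using assms by (auto simp: admissible_def is_column_def words_def)
  have hall: "length (x # vs) \<le> card (gaps U \<inter> {..<x})" if split: "I_list U = us @ x # vs" for us x vs
  proof -
    have x: "x \<in> doubles U" using split set_I_list[of U] by auto
    have "set (x # vs) \<subseteq> doubles U"
      using split set_I_list[of U] by auto
    moreover have "doubles U \<subseteq> {1..}"
      using U by (auto simp: doubles_def alphabet_def)
    moreover have "set (x # vs) \<subseteq> {..x}"
      using desc unfolding split by (auto simp: sorted_wrt_append intro: less_imp_le)
    ultimately have "set (x # vs) \<subseteq> doubles U \<inter> {1..x}" by fastforce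
    moreover have "distinct (x # vs)"
      using split by (metis I_list_def distinct_append distinct_rev distinct_sorted_list_of_set)
    ultimately have "length (x # vs) \<le> card (doubles U \<inter> {1..x})"
      by (metis card_mono distinct_card finite_Int finite_atLeastAtMost)
    also have "\<dots> \<le> card (gaps U \<inter> {1..x})"
    proof -
      have "card (low (set U) 1 x) \<le> x + 1 - 1"
        using admissible_right_of[OF assms] unfolding right_of_def by blast
      then show ?thesis using card_low[of 1 U x] by simp
    qed
    also have "gaps U \<inter> {1..x} = gaps U \<inter> {..<x}"
      using x by (auto simp: gaps_def doubles_def le_less)
    finally show ?thesis .
  qed
  have "J_list U = greedy U x0 (I_list U)"
    by (simp add: J_list_def Cons)
  with greedy_correct[of "I_list U" U x0] hall hall[of "[]" x0 xs0] Cons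
  show ?thesis by auto
qed

lemma set_l_col: "set (l_col U) = set U - Unbarred ` doubles U \<union> Unbarred ` set (J_list U)"
  by (simp add: l_col_def set_I_list)

lemma set_r_col: "set (r_col U) = set U - Barred ` doubles U \<union> Barred ` set (J_list U)"
  by (simp add: r_col_def set_I_list)

text \<open>Each x in I lies above its partner y in J, and y occurs in lU. So \<open>a\<close>
  bounds U from below, and a double in \<open>{t..m}\<close> has its partner in the same window.
  Hence gaps are at least as many as doubles there, and \<open>card_low\<close> applies.\<close>

lemma right_of_if_l_col:
  assumes adm: "admissible n U" and a: "a \<in> alphabet n" and le: "\<And>x. x \<in> set (l_col U) \<Longrightarrow> a \<le> x"
  shows "right_of (set U) a"
  unfolding right_of_def
proof (intro conjI allI impI ballI)
  note J = J_list_correct[OF adm]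
  have len: "length (J_list U) = length (I_list U)" using J list_all2_lengthD by blast
  have lt: "J_list U ! k < I_list U ! k" if "k < length (I_list U)" for k
    using J that by (auto simp: list_all2_conv_all_nth)
  have aJ: "a \<le> Unbarred y" if "y \<in> set (J_list U)" for y
    using le that by (auto simp: set_l_col)
  show "a \<le> x" if x: "x \<in> set U" for x
  proof (cases "x \<in> Unbarred ` doubles U")
    case True
    then obtain z where z: "x = Unbarred z" "z \<in> set (I_list U)"
      using set_I_list by auto
    then obtain k where k: "k < length (I_list U)" "I_list U ! k = z"
      by (auto simp: in_set_conv_nth)
    then have "a \<le> Unbarred (J_list U ! k)" using len by (intro aJ) auto
    also have "\<dots> \<le> x" using lt[OF k(1)] k z by simp
    finally show ?thesis .
  next
    case False
    then show ?thesis using x by (intro le) (auto simp: set_l_col)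
  qed
  fix t m assume t: "a = Unbarred t"
  have t1: "1 \<le> t" using a t by (auto simp: alphabet_def)
  \<comment> \<open>Working with indices matches each double with its partner; distinctness of
    \<open>J_list U\<close> makes the matching injective.\<close>
  define K where "K = {k. k < length (I_list U) \<and> I_list U ! k \<le> m}"
  have "doubles U \<inter> {t..m} \<subseteq> (!) (I_list U) ` K"
    using set_I_list[of U] by (force simp: K_def in_set_conv_nth)
  then have "card (doubles U \<inter> {t..m}) \<le> card K"
    by (rule surj_card_le[rotated]) (simp add: K_def)
  also have "card K = card ((!) (J_list U) ` K)"
    using J len by (subst card_image) (auto simp: inj_on_def K_def nth_eq_iff_index_eq)
  also have "\<dots> \<le> card (gaps U \<inter> {t..m})"
  proof (rule card_mono)
    show "(!) (J_list U) ` K \<subseteq> gaps U \<inter> {t..m}"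
    proof
      fix y assume "y \<in> (!) (J_list U) ` K"
      then obtain k where k: "y = J_list U ! k" "k < length (I_list U)" "I_list U ! k \<le> m"
        by (auto simp: K_def)
      then have "y \<in> set (J_list U)" using len by auto
      with J aJ[of y] t lt[OF k(2)] k show "y \<in> gaps U \<inter> {t..m}" by auto
    qed
  qed simp
  finally show "card (low (set U) t m) \<le> m + 1 - t"
    using card_low[OF t1, of U m] by linarith
qed

text \<open>New letters of rU are barred and appear only when U has a double. Then U contains an
  unbarred letter, so its top is unbarred and lies below them.\<close>

lemma hd_le_r_col:
  assumes "sorted_wrt (<) U" "x \<in> set (r_col U)" "admissible n U"
  shows "hd U \<le> x"
proof -
  have ne: "U \<noteq> []"
    using assms(2,3) J_list_correct[OF assms(3)] set_I_list[of U]
    by (auto simp: set_r_col doubles_def list_all2_Cons2)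
  have hd: "hd U \<le> y" if "y \<in> set U" for y
    using assms(1) that by (cases U) auto
  show ?thesis
  proof (cases "x \<in> set U")
    case True
    then show ?thesis by (rule hd)
  next
    case False
    then obtain y where y: "x = Barred y" "y \<in> set (J_list U)"
      using assms(2) by (auto simp: set_r_col)
    then have "I_list U \<noteq> []" by (auto simp: J_list_def)
    then obtain z where "z \<in> doubles U" using set_I_list[of U] by (cases "I_list U") auto
    then have "hd U \<le> Unbarred z" using hd by (auto simp: doubles_def)
    then show ?thesis using y by (cases "hd U") auto
  qed
qed

text \<open>The top row gives the chain: top of U, top of rU, top of lV, any letter of lV.\<close>

lemma col_preceq_right_of:
  assumes "col_preceq U V" "admissible n U" "admissible n V" "U \<noteq> []"
  shows "right_of (set V) (hd U)"
proof (rule right_of_if_l_col[OF assms(3)])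
  have U: "sorted_wrt (<) U" "set U \<subseteq> alphabet n"
    using assms(2) by (auto simp: admissible_def is_column_def words_def)
  show "hd U \<in> alphabet n" using U(2) assms(4) hd_in_set by blast
  fix x assume x: "x \<in> set (l_col V)"
  then have len: "length (l_col V) > 0" by (cases "l_col V") auto
  then have "r_col U ! 0 \<le> l_col V ! 0" "r_col U ! 0 \<in> set (r_col U)"
    using assms(1) by (auto simp: col_preceq_def col_le_def intro!: nth_mem)
  moreover have "hd U \<le> r_col U ! 0"
    using hd_le_r_col[OF U(1) _ assms(2)] calculation(2) .
  moreover have "l_col V ! 0 \<le> x"
  proof -
    have "sorted (l_col V)" by (simp add: l_col_def)
    with x show ?thesis by (cases "l_col V") auto
  qed
  ultimately show "hd U \<le> x" by order
qed

lemma symplectic_top_tableau: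
  assumes "symplectic_tableau n T"
  shows "top_tableau n (rev T)"
proof -
  \<comment> \<open>The strengthening identifies \<open>next_top\<close> with the top of the left
    neighbour of the column appended next.\<close>
  have "top_tableau n (rev T) \<and> (T \<noteq> [] \<longrightarrow> next_top (rev T) = hd (last T))"
    using assms
  proof (induction T rule: rev_induct)
    case (snoc U T)
    have tab: "symplectic_tableau n T"
      unfolding symplectic_tableau_def
    proof (intro conjI allI impI)
      fix k assume "Suc k < length T"
      then show "col_preceq (T ! k) (T ! Suc k)"
        using snoc.prems unfolding symplectic_tableau_def
        by (metis Suc_lessD length_append_singleton less_SucI nth_append)
    qed (use snoc.prems in \<open>auto simp: symplectic_tableau_def\<close>)
    note IH = snoc.IH[OF tab]
    have U: "U \<noteq> []" "admissible n U" using snoc.prems by (auto simp: symplectic_tableau_def)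
    have "right_of (set U) (next_top (rev T))"
    proof (cases T rule: rev_cases)
      case Nil
      then show ?thesis using admissible_right_of[OF U(2)] by simp
    next
      case (snoc T' U')
      then have "Suc (length T') < length (T @ [U])" by simp
      then have "col_preceq ((T @ [U]) ! length T') ((T @ [U]) ! Suc (length T'))"
        using snoc.prems unfolding symplectic_tableau_def by blast
      then have "col_preceq U' U" using snoc by (simp add: nth_append)
      then have "right_of (set U) (hd U')"
        using tab snoc U by (intro col_preceq_right_of) (auto simp: symplectic_tableau_def)
      then show ?thesis using snoc by simp
    qed
    then show ?case
      using IH U by (auto simp: admissible_def is_column_def words_def)
  qed simp
  then show ?thesis ..
qed

section \<open>Comparing weights across the isomorphism\<close>

theorem lemma3p3p7:
  fixes n :: nat and U V :: "letter list" and T :: "letter list list"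
  assumes "n \<ge> 1"
    and "admissible n U" and "admissible n V"
    and "is_P n (U @ V) T"
  shows "length T \<le> 2"
proof -
  from assms(4) obtain \<phi> where T: "symplectic_tableau n T"
    and \<phi>: "crystal_iso n (U @ V) (tableau_reading T) \<phi>"
    by (auto simp: is_P_def crystal_equiv_def)
  obtain Cs where Cs: "top_tableau n Cs" "length Cs = length T" "next_top Cs = Unbarred 1"
    "concat Cs \<in> component n (tableau_reading T)"
    using raise_to_top[OF symplectic_top_tableau[OF T] assms(1)] by (auto simp: tableau_reading_def)
  \<comment> \<open>Surjectivity of \<open>\<phi>\<close> pulls the raised word, whose weight counts
    the columns of \<open>T\<close>, back to a word in the component of
    \<open>U @ V\<close>.\<close>
  moreover have "\<phi> ` component n (U @ V) = component n (tableau_reading T)"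
    using \<phi> unfolding crystal_iso_def by (blast dest: bij_betw_imp_surj_on)
  ultimately obtain z where z: "z \<in> component n (U @ V)" "\<phi> z = concat Cs"
    by (metis imageE)
  have "two_columns (U @ V)"
    using assms(2,3) by (auto simp: two_columns_def admissible_def is_column_def)
  with z(1) have "weight z 1 \<le> 2"
    using weight_two_columns two_columns_component by blast
  moreover have "\<forall>a\<in>component n (U @ V). \<forall>i\<in>{1..n}. weight (\<phi> a) i = weight a i"
    using \<phi> by (simp add: crystal_iso_def)
  then have "weight (concat Cs) 1 = weight z 1"
    using z assms(1) by fastforce
  ultimately show ?thesis
    using top_tableau_weight[OF Cs(1) assms(1) Cs(3)] Cs(2) by simp
qed

end
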